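(* Let $n$ be an odd positive integer, $S=\{0,\dots,n-1\}$, and let $\alpha_1,\alpha_2,\alpha_3\in\{1,\dots,n-1\}$. Define the $n\times n\times n$ array $C$ by $C_{ijk}\equiv\alpha_1 i+\alpha_2 j+\alpha_3 k\pmod n$, $i,j,k\in S$, $C_{ijk}\in S$. Suppose, with $A=\alpha_1+\alpha_2+\alpha_3$: $\gcd(\alpha_\ell,n)=1$ for $\ell=1,2,3$; $\gcd(\alpha_\ell+\alpha_{\ell'},n)=1$ and $\gcd(\alpha_\ell-\alpha_{\ell'},n)=1$ for all $\ell\ne\ell'$ in $\{1,2,3\}$; $\gcd(A,n)=1$; and $\gcd(A-2\alpha_\ell,n)=1$ for $\ell=1,2,3$. Then $C$ is a pandiagonal latin cube.
   Context: An $n\times n$ array $(A_{xy})_{x,y\in S}$ with entries in $S$ is a pandiagonal latin square if for each $c\in S$ each of the index sets $\{(x,c)\}_x$, $\{(c,y)\}_y$, $\{(x,x+c\bmod n)\}_x$, $\{(x,c-x\bmod n)\}_x$ contains each element of $S$ exactly once among its entries. The $3n+6$ constituent squares of an $n\times n\times n$ array $C$ are: the $3n$ squares obtained by fixing one of $i,j,k$ to a value in $S$ (indexed by the other two coordinates), and the six diagonal squares $(C_{iik})_{i,k}$, $(C_{i,n-1-i,k})_{i,k}$, $(C_{iji})_{i,j}$, $(C_{i,j,n-1-i})_{i,j}$, $(C_{ijj})_{i,j}$, $(C_{i,j,n-1-j})_{i,j}$. $C$ (with entries in $S$) is a pandiagonal latin cube if each of its $3n+6$ constituent squares is a pandiagonal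 latin square. *)

theory Defs
  imports "HOL-Number_Theory.Cong"
begin

text \<open>
  Arrays of order \<open>n\<close> are functions on \<^typ>\<open>int\<close> of which only the values at indices in
  \<open>{0..<n}\<close> matter; integers are used so that \<open>c - x\<close> and \<open>n - 1 - i\<close> are not truncated.
\<close>

definition pandiagonal_latin_square :: "int \<Rightarrow> (int \<Rightarrow> int \<Rightarrow> int) \<Rightarrow> bool" where
  "pandiagonal_latin_square n A \<longleftrightarrow>
     (\<forall>x\<in>{0..<n}. \<forall>y\<in>{0..<n}. A x y \<in> {0..<n}) \<and>
     (\<forall>c\<in>{0..<n}. \<forall>s\<in>{0..<n}.
        (\<exists>!x. x \<in> {0..<n} \<and> A x c = s) \<and>
        (\<exists>!y. y \<in> {0..<n} \<and> A c y = s) \<and>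
        (\<exists>!x. x \<in> {0..<n} \<and> A x ((x + c) mod n) = s) \<and>
        (\<exists>!x. x \<in> {0..<n} \<and> A x ((c - x) mod n) = s))"

definition constituent_squares ::
    "int \<Rightarrow> (int \<Rightarrow> int \<Rightarrow> int \<Rightarrow> int) \<Rightarrow> (int \<Rightarrow> int \<Rightarrow> int) set" where
  "constituent_squares n C =
     {\<lambda>j k. C i j k | i. i \<in> {0..<n}} \<union>
     {\<lambda>i k. C i j k | j. j \<in> {0..<n}} \<union>
     {\<lambda>i j. C i j k | k. k \<in> {0..<n}} \<union>
     {\<lambda>i k. C i i k, \<lambda>i k. C i (n - 1 - i) k,
      \<lambda>i j. C i j i, \<lambda>i j. C i j (n - 1 - i),
      \<lambda>i j. C i j j, \<lambda>i j. C i j (n - 1 - j)}"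

definition pandiagonal_latin_cube :: "int \<Rightarrow> (int \<Rightarrow> int \<Rightarrow> int \<Rightarrow> int) \<Rightarrow> bool" where
  "pandiagonal_latin_cube n C \<longleftrightarrow>
     (\<forall>i\<in>{0..<n}. \<forall>j\<in>{0..<n}. \<forall>k\<in>{0..<n}. C i j k \<in> {0..<n}) \<and>
     (\<forall>A\<in>constituent_squares n C. pandiagonal_latin_square n A)"

end

theory Submission
  imports Defs
begin

text \<open>
  Modulo \<open>n\<close>, every constituent square is affine, \<open>(x, y) \<mapsto> a x + b y + c\<close>, and along a row,
  column or broken diagonal it is affine in one variable with slope \<open>b\<close>, \<open>a\<close>, \<open>a + b\<close> or
  \<open>a - b\<close>. A line takes every value once as soon as its slope is a unit; the gcd hypotheses
  say that all slopes that occur are units, up to sign.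
\<close>

lemma bij_betw_affine_mod:
  fixes a b n :: int
  assumes "coprime a n"
  shows "bij_betw (\<lambda>x. (a * x + b) mod n) {0..<n} {0..<n}"
proof -
  have inj: "inj_on (\<lambda>x. (a * x + b) mod n) {0..<n}"
  proof (rule inj_onI)
    fix x y
    assume x: "x \<in> {0..<n}" and y: "y \<in> {0..<n}" and "(a * x + b) mod n = (a * y + b) mod n"
    then have "[a * x + b = a * y + b] (mod n)"
      by (simp add: cong_def)
    then have "[x = y] (mod n)"
      using \<open>coprime a n\<close> by (simp add: cong_add_rcancel cong_mult_lcancel)
    then show "x = y"
      using x y by (simp add: cong_def)
  qed
  moreover have "(\<lambda>x. (a * x + b) mod n) ` {0..<n} = {0..<n}"
    by (rule endo_inj_surj[OF _ _ inj]) auto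
  ultimately show ?thesis
    by (rule bij_betw_imageI)
qed

lemma bij_betw_imp_ex1:
  assumes "bij_betw f A B" and "y \<in> B"
  shows "\<exists>!x. x \<in> A \<and> f x = y"
  using assms unfolding bij_betw_def inj_on_def by blast

lemma pandiagonal_latin_squareI:
  assumes column: "\<And>c. c \<in> {0..<n} \<Longrightarrow> bij_betw (\<lambda>x. M x c) {0..<n} {0..<n}"
    and row: "\<And>c. c \<in> {0..<n} \<Longrightarrow> bij_betw (\<lambda>y. M c y) {0..<n} {0..<n}"
    and diagonal: "\<And>c. c \<in> {0..<n} \<Longrightarrow> bij_betw (\<lambda>x. M x ((x + c) mod n)) {0..<n} {0..<n}"
    and antidiagonal: "\<And>c. c \<in> {0..<n} \<Longrightarrow> bij_betw (\<lambda>x. M x ((c - x) mod n)) {0..<n} {0..<n}"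
  shows "pandiagonal_latin_square n M"
  unfolding pandiagonal_latin_square_def
proof (intro conjI ballI)
  fix x y assume "x \<in> {0..<n}" "y \<in> {0..<n}"
  then show "M x y \<in> {0..<n}"
    by (rule bij_betw_apply[OF row])
next
  fix c s assume c: "c \<in> {0..<n}" and s: "s \<in> {0..<n}"
  show "\<exists>!x. x \<in> {0..<n} \<and> M x c = s"
    by (rule bij_betw_imp_ex1[OF column[OF c] s])
  show "\<exists>!y. y \<in> {0..<n} \<and> M c y = s"
    by (rule bij_betw_imp_ex1[OF row[OF c] s])
  show "\<exists>!x. x \<in> {0..<n} \<and> M x ((x + c) mod n) = s"
    by (rule bij_betw_imp_ex1[OF diagonal[OF c] s])
  show "\<exists>!x. x \<in> {0..<n} \<and> M x ((c - x) mod n) = s"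
    by (rule bij_betw_imp_ex1[OF antidiagonal[OF c] s])
qed

definition pandiagonal_coeffs :: "int \<Rightarrow> int \<Rightarrow> int \<Rightarrow> bool" where
  "pandiagonal_coeffs n a b \<longleftrightarrow>
     coprime a n \<and> coprime b n \<and> coprime (a + b) n \<and> coprime (a - b) n"

lemma pandiagonal_latin_square_affine:
  assumes coeffs: "pandiagonal_coeffs n a b"
    and M: "\<And>x y. x \<in> {0..<n} \<Longrightarrow> y \<in> {0..<n} \<Longrightarrow> M x y = (a * x + b * y + c) mod n"
  shows "pandiagonal_latin_square n M"
proof -
  have affine_line: "bij_betw f {0..<n} {0..<n}"
    if "coprime p n" and "\<And>x. x \<in> {0..<n} \<Longrightarrow> f x = (p * x + q) mod n" for f p q
    by (rule bij_betw_cong[THEN iffD2, OF _ bij_betw_affine_mod[OF that(1)]]) (rule that(2))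
  have slopes: "coprime a n" "coprime b n" "coprime (a + b) n" "coprime (a - b) n"
    using coeffs by (simp_all add: pandiagonal_coeffs_def)
  have M_mod: "M x (z mod n) = (a * x + b * z + c) mod n" if "x \<in> {0..<n}" for x z
  proof -
    have "[a * x + b * (z mod n) + c = a * x + b * z + c] (mod n)"
      by (intro cong_add cong_mult cong_refl) (simp add: cong_def)
    moreover have "z mod n \<in> {0..<n}"
      using that by simp
    ultimately show ?thesis
      using that by (simp only: M cong_def)
  qed
  show ?thesis
  proof (rule pandiagonal_latin_squareI)
    fix d assume d: "d \<in> {0..<n}"
    show "bij_betw (\<lambda>x. M x d) {0..<n} {0..<n}"
      by (rule affine_line[OF slopes(1), where q = "b * d + c"])
        (use d in \<open>simp add: M algebra_simps\<close>)
    show "bij_betw (\<lambda>y. M d y) {0..<n} {0..<n}"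
      by (rule affine_line[OF slopes(2), where q = "a * d + c"])
        (use d in \<open>simp add: M algebra_simps\<close>)
    show "bij_betw (\<lambda>x. M x ((x + d) mod n)) {0..<n} {0..<n}"
      by (rule affine_line[OF slopes(3), where q = "b * d + c"]) (simp add: M_mod algebra_simps)
    show "bij_betw (\<lambda>x. M x ((d - x) mod n)) {0..<n} {0..<n}"
      by (rule affine_line[OF slopes(4), where q = "b * d + c"]) (simp add: M_mod algebra_simps)
  qed
qed

lemma pandiagonal_latin_cube_affine:
  assumes C: "\<And>i j k. i \<in> {0..<n} \<Longrightarrow> j \<in> {0..<n} \<Longrightarrow> k \<in> {0..<n} \<Longrightarrow>
      C i j k = (a * i + b * j + c * k + d) mod n"
    and faces: "pandiagonal_coeffs n b c" "pandiagonal_coeffs n a c" "pandiagonal_coeffs n a b"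
    and diagonals: "pandiagonal_coeffs n (a + b) c" "pandiagonal_coeffs n (a - b) c"
      "pandiagonal_coeffs n (a + c) b" "pandiagonal_coeffs n (a - c) b"
      "pandiagonal_coeffs n a (b + c)" "pandiagonal_coeffs n a (b - c)"
  shows "pandiagonal_latin_cube n C"
proof -
  note affine_square = pandiagonal_latin_square_affine
  have "pandiagonal_latin_square n (\<lambda>j k. C i j k)" if "i \<in> {0..<n}" for i
    by (rule affine_square[OF faces(1), where c = "a * i + d"])
      (use that in \<open>simp add: C algebra_simps\<close>)
  moreover have "pandiagonal_latin_square n (\<lambda>i k. C i j k)" if "j \<in> {0..<n}" for j
    by (rule affine_square[OF faces(2), where c = "b * j + d"])
      (use that in \<open>simp add: C algebra_simps\<close>)
  moreover have "pandiagonal_latin_square n (\<lambda>i j. C i j k)" if "k \<in> {0..<n}" for k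
    by (rule affine_square[OF faces(3), where c = "c * k + d"])
      (use that in \<open>simp add: C algebra_simps\<close>)
  moreover have "pandiagonal_latin_square n (\<lambda>i k. C i i k)"
    by (rule affine_square[OF diagonals(1), where c = d]) (simp add: C algebra_simps)
  moreover have "pandiagonal_latin_square n (\<lambda>i k. C i (n - 1 - i) k)"
    by (rule affine_square[OF diagonals(2), where c = "b * (n - 1) + d"])
      (simp add: C algebra_simps)
  moreover have "pandiagonal_latin_square n (\<lambda>i j. C i j i)"
    by (rule affine_square[OF diagonals(3), where c = d]) (simp add: C algebra_simps)
  moreover have "pandiagonal_latin_square n (\<lambda>i j. C i j (n - 1 - i))"
    by (rule affine_square[OF diagonals(4), where c = "c * (n - 1) + d"])
      (simp add: C algebra_simps)
  moreover have "pandiagonal_latin_square n (\<lambda>i j. C i j j)"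
    by (rule affine_square[OF diagonals(5), where c = d]) (simp add: C algebra_simps)
  moreover have "pandiagonal_latin_square n (\<lambda>i j. C i j (n - 1 - j))"
    by (rule affine_square[OF diagonals(6), where c = "c * (n - 1) + d"])
      (simp add: C algebra_simps)
  moreover have "C i j k \<in> {0..<n}" if "i \<in> {0..<n}" "j \<in> {0..<n}" "k \<in> {0..<n}" for i j k
    using that by (simp add: C)
  ultimately show ?thesis
    unfolding pandiagonal_latin_cube_def constituent_squares_def by blast
qed

theorem mainTheorem5:
  fixes n A :: int and S :: "int set" and \<alpha> :: "nat \<Rightarrow> int"
    and C :: "int \<Rightarrow> int \<Rightarrow> int \<Rightarrow> int"
  assumes "n > 0" and "odd n" and "S = {0..<n}"
    and "\<forall>l\<in>{1,2,3}. \<alpha> l \<in> {1..n - 1}"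
    and "\<forall>i\<in>S. \<forall>j\<in>S. \<forall>k\<in>S.
           C i j k \<in> S \<and> [C i j k = \<alpha> 1 * i + \<alpha> 2 * j + \<alpha> 3 * k] (mod n)"
    and "A = \<alpha> 1 + \<alpha> 2 + \<alpha> 3"
    and "\<forall>l\<in>{1,2,3}. gcd (\<alpha> l) n = 1"
    and "\<forall>l\<in>{1,2,3}. \<forall>l'\<in>{1,2,3}. l \<noteq> l' \<longrightarrow>
           gcd (\<alpha> l + \<alpha> l') n = 1 \<and> gcd (\<alpha> l - \<alpha> l') n = 1"
    and "gcd A n = 1"
    and "\<forall>l\<in>{1,2,3}. gcd (A - 2 * \<alpha> l) n = 1"
  shows "pandiagonal_latin_cube n C"
proof (rule pandiagonal_latin_cube_affine)
  fix i j k assume "i \<in> {0..<n}" "j \<in> {0..<n}" "k \<in> {0..<n}"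
  then have "C i j k \<in> {0..<n}" "[C i j k = \<alpha> 1 * i + \<alpha> 2 * j + \<alpha> 3 * k] (mod n)"
    using assms(3,5) by simp_all
  then show "C i j k = (\<alpha> 1 * i + \<alpha> 2 * j + \<alpha> 3 * k + 0) mod n"
    by (simp add: cong_def)
next
  have singles: "coprime (\<alpha> l) n" if "l \<in> {1,2,3}" for l
    using assms(7) that unfolding coprime_iff_gcd_eq_1 by blast
  have pairs: "coprime (\<alpha> l + \<alpha> l') n" "coprime (\<alpha> l - \<alpha> l') n"
    if "l \<in> {1,2,3}" "l' \<in> {1,2,3}" "l \<noteq> l'" for l l'
    using assms(8) that unfolding coprime_iff_gcd_eq_1 by blast+
  have triples: "coprime (\<alpha> 1 + \<alpha> 2 + \<alpha> 3) n" "coprime (\<alpha> 1 + \<alpha> 2 - \<alpha> 3) n"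
    "coprime (\<alpha> 1 - \<alpha> 2 + \<alpha> 3) n" "coprime (\<alpha> 2 + \<alpha> 3 - \<alpha> 1) n"
    using assms(9,10) by (simp_all add: assms(6) coprime_iff_gcd_eq_1 algebra_simps)
  have negated: "coprime (\<alpha> 1 - \<alpha> 2 - \<alpha> 3) n"
    using triples(4) coprime_minus_left_iff[of "\<alpha> 2 + \<alpha> 3 - \<alpha> 1" n] by (simp add: algebra_simps)
  show "pandiagonal_coeffs n (\<alpha> 2) (\<alpha> 3)" "pandiagonal_coeffs n (\<alpha> 1) (\<alpha> 3)"
    "pandiagonal_coeffs n (\<alpha> 1) (\<alpha> 2)"
    "pandiagonal_coeffs n (\<alpha> 1 + \<alpha> 2) (\<alpha> 3)" "pandiagonal_coeffs n (\<alpha> 1 - \<alpha> 2) (\<alpha> 3)"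
    "pandiagonal_coeffs n (\<alpha> 1 + \<alpha> 3) (\<alpha> 2)" "pandiagonal_coeffs n (\<alpha> 1 - \<alpha> 3) (\<alpha> 2)"
    "pandiagonal_coeffs n (\<alpha> 1) (\<alpha> 2 + \<alpha> 3)" "pandiagonal_coeffs n (\<alpha> 1) (\<alpha> 2 - \<alpha> 3)"
    using triples negated by (simp_all add: pandiagonal_coeffs_def singles pairs algebra_simps)
qed

end
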